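(* Suppose that for every rational number $r\in[1,2]$ there exists a graph $H$ such that $ex(n,H)=\Theta(n^r)$. Then for every rational number $r\in[\frac{1}{2},1]$ there exists a graph $H_r$ such that $spex(n,H_r)=\Theta(n^r)$. Moreover, for every rational number $0<r<\frac{1}{2}$, there is no graph $H$ such that $spex(n,H)=\Theta(n^r)$.
   Context: All graphs are finite and simple. A graph $G$ is $H$-free if it contains no (not necessarily induced) subgraph isomorphic to $H$. The Turán number $ex(n,H)$ is the maximum number of edges of an $n$-vertex $H$-free graph, and the spectral Turán number $spex(n,H)$ is the maximum spectral radius (largest eigenvalue of the adjacency matrix) of an $n$-vertex $H$-free graph. *)

theory Defs
  imports Complex_Main "HOL-Library.Landau_Symbols" "Jordan_Normal_Form.Char_Poly"
begin

text \<open>A graph is given by its vertex set and its set of edges, an edge being the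
  two-element set of its endpoints.\<close>

type_synonym 'a ugraph = "'a set \<times> 'a set set"

abbreviation vertices :: "'a ugraph \<Rightarrow> 'a set" where
  "vertices G \<equiv> fst G"

abbreviation edges :: "'a ugraph \<Rightarrow> 'a set set" where
  "edges G \<equiv> snd G"

definition simple_graph :: "'a ugraph \<Rightarrow> bool" where
  "simple_graph G \<longleftrightarrow> finite (vertices G) \<and> (\<forall>e \<in> edges G. e \<subseteq> vertices G \<and> card e = 2)"

definition subgraph_of :: "'a ugraph \<Rightarrow> 'a ugraph \<Rightarrow> bool" where
  "subgraph_of S G \<longleftrightarrow> simple_graph S \<and> vertices S \<subseteq> vertices G \<and> edges S \<subseteq> edges G"

definition graph_isomorphic :: "'a ugraph \<Rightarrow> 'b ugraph \<Rightarrow> bool" where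
  "graph_isomorphic G H \<longleftrightarrow>
     (\<exists>f. bij_betw f (vertices G) (vertices H) \<and> edges H = (\<lambda>e. f ` e) ` edges G)"

definition graph_free :: "'b ugraph \<Rightarrow> 'a ugraph \<Rightarrow> bool" where
  "graph_free H G \<longleftrightarrow> \<not> (\<exists>S. subgraph_of S G \<and> graph_isomorphic H S)"

text \<open>Every graph on \<open>n\<close> vertices is isomorphic to one with vertex set \<open>{..<n}\<close>, and
  \<open>H\<close>-freeness, the number of edges and the eigenvalues are isomorphism invariants, so
  \<open>n\<close>-vertex graphs are taken on \<open>{..<n}\<close>.\<close>

definition free_graphs :: "nat \<Rightarrow> 'b ugraph \<Rightarrow> nat ugraph set" where
  "free_graphs n H = {G. simple_graph G \<and> vertices G = {..<n} \<and> graph_free H G}"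

definition adjacency_matrix :: "nat \<Rightarrow> nat ugraph \<Rightarrow> real mat" where
  "adjacency_matrix n G = mat n n (\<lambda>(i, j). if {i, j} \<in> edges G then 1 else 0)"

text \<open>An adjacency matrix is real symmetric, so for \<open>n > 0\<close> the set of its real eigenvalues
  is finite and nonempty and contains all its complex eigenvalues. For \<open>n = 0\<close> there are no
  eigenvalues and the value is unspecified, which does not affect asymptotic statements.\<close>

definition graph_spectral_radius :: "nat \<Rightarrow> nat ugraph \<Rightarrow> real" where
  "graph_spectral_radius n G = Max {k. eigenvalue (adjacency_matrix n G) k}"

text \<open>If \<open>H\<close> has no edges and at most \<open>n\<close> vertices, there is no \<open>H\<close>-free graph on \<open>n\<close>
  vertices; the maximum over the empty family is then taken to be \<open>0\<close>.\<close>

definition ex_num :: "nat \<Rightarrow> 'b ugraph \<Rightarrow> nat" where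
  "ex_num n H = (if free_graphs n H = {} then 0
     else Max ((\<lambda>G. card (edges G)) ` free_graphs n H))"

definition spex_num :: "nat \<Rightarrow> 'b ugraph \<Rightarrow> real" where
  "spex_num n H = (if free_graphs n H = {} then 0
     else Max (graph_spectral_radius n ` free_graphs n H))"

end

theory Submission
  imports Defs "HOL-Analysis.Function_Topology" "HOL-Analysis.Convex" "HOL-Real_Asymp.Real_Asymp"
    "Jordan_Normal_Form.Spectral_Radius"
begin

text \<open>For \<open>s > 1/2\<close>, \<open>ex(n, H) = \<Theta>(n\<^bsup>1+s\<^esup>)\<close> forces \<open>spex(n, H) = \<Theta>(n\<^sup>s)\<close>. The average degree
  gives the lower bound. For the upper bound, cutting the larger of two vertex sets into pieces of
  the size of the smaller one yields \<open>e(A, B) = O((|A| + |B|) |A|\<^sup>s)\<close>. If \<open>x\<close> is the absolute value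
  of an eigenvector and \<open>A\<close> maximises \<open>x(A) / |A|\<^sup>s\<close>, then in \<open>\<lambda> x(A) \<le> \<Sum>v. d\<^sub>A(v) x(v)\<close> the
  vertices with \<open>d\<^sub>A(v) = O(|A|\<^sup>s)\<close> contribute \<open>O(n\<^sup>s x(A))\<close>, and the others form a set of size at most
  \<open>|A|\<close> on which the sums of \<open>d\<^sub>A\<close> and of \<open>x\<close> grow sublinearly, so that their contribution is a
  geometric series, convergent because \<open>2s > 1\<close>. The exponent \<open>1/2\<close> is realised by two disjoint
  edges. Below \<open>1/2\<close> nothing occurs: either all stars are \<open>H\<close>-free, and \<open>spex(n, H) \<ge> \<surd>(n - 1)\<close>,
  or \<open>H\<close> lies in a star and \<open>H\<close>-free graphs have bounded degree.\<close>

section \<open>Rayleigh quotients of symmetric matrices\<close>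

text \<open>Replaces vectors by plain functions, so that the spectral arguments become computations
  with finite sums. Only the values of \<open>y\<close> below \<open>n\<close> matter.\<close>

lemma eigenvalue_mat_iff:
  fixes a :: "nat \<Rightarrow> nat \<Rightarrow> real"
  shows "eigenvalue (mat n n (\<lambda>(i, j). a i j)) k \<longleftrightarrow>
    (\<exists>y. (\<exists>i<n. y i \<noteq> 0) \<and> (\<forall>i<n. (\<Sum>j<n. a i j * y j) = k * y i))"
proof
  let ?A = "mat n n (\<lambda>(i, j). a i j)"
  assume "eigenvalue ?A k"
  then obtain v where v: "v \<in> carrier_vec n" "v \<noteq> 0\<^sub>v n" "?A *\<^sub>v v = k \<cdot>\<^sub>v v"
    by (auto simp: eigenvalue_def eigenvector_def)
  have "\<exists>i<n. vec_index v i \<noteq> 0"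
    using v(1,2) by (metis carrier_vecD eq_vecI index_zero_vec)
  moreover have "(\<Sum>j<n. a i j * vec_index v j) = k * vec_index v i" if "i < n" for i
  proof -
    have "vec_index (?A *\<^sub>v v) i = vec_index (k \<cdot>\<^sub>v v) i" by (simp add: v(3))
    thus ?thesis using that v(1) by (simp add: scalar_prod_def atLeast0LessThan)
  qed
  ultimately show "\<exists>y. (\<exists>i<n. y i \<noteq> 0) \<and> (\<forall>i<n. (\<Sum>j<n. a i j * y j) = k * y i)"
    by blast
next
  let ?A = "mat n n (\<lambda>(i, j). a i j)"
  assume "\<exists>y. (\<exists>i<n. y i \<noteq> 0) \<and> (\<forall>i<n. (\<Sum>j<n. a i j * y j) = k * y i)"
  then obtain y where y: "\<exists>i<n. y i \<noteq> 0" "\<And>i. i < n \<Longrightarrow> (\<Sum>j<n. a i j * y j) = k * y i"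
    by blast
  have "vec n y \<noteq> 0\<^sub>v n" using y(1) by (metis index_vec index_zero_vec(1))
  moreover have "?A *\<^sub>v vec n y = k \<cdot>\<^sub>v vec n y"
    by (rule eq_vecI) (auto simp: scalar_prod_def atLeast0LessThan y(2))
  ultimately have "eigenvector ?A (vec n y) k" by (simp add: eigenvector_def)
  thus "eigenvalue ?A k" by (auto simp: eigenvalue_def)
qed

text \<open>First-order optimality: near \<open>t = 0\<close> the linear term dominates and changes
  sign with \<open>t\<close>.\<close>

lemma quadratic_nonneg_imp_linear_coeff_0:
  fixes b c :: real
  assumes "\<And>t. 0 \<le> t\<^sup>2 * c + 2 * t * b"
  shows "b = 0"
proof (rule ccontr)
  assume "b \<noteq> 0"
  \<comment> \<open>At \<open>t = - b / C\<close> the quadratic equals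
    \<open>(b / C)^2 * (c - 2 * C)\<close>, which is negative because
    \<open>C > \<bar>c\<bar>\<close>.\<close>
  define C where "C = \<bar>c\<bar> + 1"
  have C: "C > 0" "c - 2 * C < 0" by (auto simp: C_def)
  have "(- b / C)\<^sup>2 * c + 2 * (- b / C) * b = (b / C)\<^sup>2 * (c - 2 * C)"
    using C(1) by (simp add: field_simps power2_eq_square)
  also have "\<dots> < 0" using C \<open>b \<noteq> 0\<close> by (simp add: mult_pos_neg)
  finally show False using assms[of "- b / C"] by linarith
qed

text \<open>Vectors are functions padded with zeros, under the product topology. The cube
  \<open>B\<close> is a product of compact sets, and the norm condition is closed because it
  involves finitely many coordinates.\<close>

lemma compact_unit_sphere_fun:
  "compact {x :: nat \<Rightarrow> real. (\<forall>i\<ge>n. x i = 0) \<and> (\<Sum>i<n. (x i)\<^sup>2) = 1}"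
proof -
  define B where "B = (\<Pi>\<^sub>E i\<in>UNIV. if i < n then {-1..1} else {0::real})"
  have "compactin (product_topology (\<lambda>i. euclidean) UNIV) B"
    unfolding B_def compactin_PiE by auto
  hence "compact B" by (simp add: euclidean_product_topology)
  moreover have "closed {x :: nat \<Rightarrow> real. (\<Sum>i<n. (x i)\<^sup>2) = 1}"
    by (intro closed_Collect_eq continuous_intros continuous_on_product_coordinates)
  ultimately have "compact (B \<inter> {x. (\<Sum>i<n. (x i)\<^sup>2) = 1})" by (rule compact_Int_closed)
  moreover have "B \<inter> {x. (\<Sum>i<n. (x i)\<^sup>2) = 1} = {x. (\<forall>i\<ge>n. x i = 0) \<and> (\<Sum>i<n. (x i)\<^sup>2) = 1}"
  proof (intro equalityI subsetI)
    fix x assume x: "x \<in> {x. (\<forall>i\<ge>n. x i = 0) \<and> (\<Sum>i<n. (x i)\<^sup>2) = (1::real)}"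
    have "\<bar>x i\<bar> \<le> 1" if "i < n" for i
    proof -
      have "(x i)\<^sup>2 \<le> (\<Sum>i<n. (x i)\<^sup>2)" using that by (intro member_le_sum) auto
      thus ?thesis using x by (simp add: abs_square_le_1)
    qed
    thus "x \<in> B \<inter> {x. (\<Sum>i<n. (x i)\<^sup>2) = 1}"
      using x by (auto simp: B_def abs_le_iff PiE_iff minus_le_iff)
  qed (auto simp: B_def PiE_iff not_less[symmetric] split: if_splits)
  ultimately show ?thesis by simp
qed

text \<open>By compactness the quadratic form has a maximiser on the unit sphere; it is an
  eigenvector, and its eigenvalue is the maximum.\<close>

lemma symmetric_eigenvalue_ge_rayleigh:
  fixes a :: "nat \<Rightarrow> nat \<Rightarrow> real" and x :: "nat \<Rightarrow> real"
  assumes sym: "\<And>i j. a i j = a j i" and x: "\<exists>i<n. x i \<noteq> 0"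
  obtains k where "eigenvalue (mat n n (\<lambda>(i, j). a i j)) k"
    "(\<Sum>i<n. \<Sum>j<n. x i * a i j * x j) \<le> k * (\<Sum>i<n. (x i)\<^sup>2)"
proof -
  define q where "q x = (\<Sum>i<n. \<Sum>j<n. x i * a i j * x j)" for x :: "nat \<Rightarrow> real"
  define N where "N x = (\<Sum>i<n. (x i)\<^sup>2)" for x :: "nat \<Rightarrow> real"
  define S where "S = {x :: nat \<Rightarrow> real. (\<forall>i\<ge>n. x i = 0) \<and> N x = 1}"
  \<comment> \<open>Normalisation: \<open>q\<close> and \<open>N\<close> are homogeneous of degree
    two, so bounds on the sphere extend to every nonzero vector.\<close>
  have scaled: "(\<lambda>i. if i < n then y i / sqrt (N y) else 0) \<in> S"
    "q y = N y * q (\<lambda>i. if i < n then y i / sqrt (N y) else 0)" if "N y \<noteq> 0" for y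
  proof -
    let ?y = "\<lambda>i. if i < n then y i / sqrt (N y) else 0"
    have pos: "N y > 0" using that by (simp add: N_def sum_nonneg order.not_eq_order_implies_strict)
    have "N ?y = (\<Sum>i<n. (y i)\<^sup>2 / N y)"
      unfolding N_def[of ?y] using pos by (intro sum.cong) (auto simp: power_divide)
    also have "\<dots> = 1" using pos by (simp add: sum_divide_distrib[symmetric] N_def)
    finally show "?y \<in> S" by (simp add: S_def)
    have "N y * q ?y = (\<Sum>i<n. \<Sum>j<n. N y * (?y i * a i j * ?y j))"
      by (simp add: q_def sum_distrib_left)
    also have "\<dots> = q y"
      unfolding q_def using pos by (intro sum.cong refl) (simp add: field_simps)
    finally show "q y = N y * q ?y" by simp
  qed
  have "compact S" unfolding S_def N_def by (rule compact_unit_sphere_fun)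
  moreover have Nx: "N x \<noteq> 0"
    using x by (auto simp: N_def sum_nonneg_eq_0_iff)
  moreover have "continuous_on S q" unfolding q_def
    by (intro continuous_intros continuous_on_subset[OF continuous_on_product_coordinates]) auto
  ultimately obtain z where z: "z \<in> S" "\<And>y. y \<in> S \<Longrightarrow> q y \<le> q z"
    using continuous_attains_sup[of S q] scaled(1)[OF Nx] by blast
  define k where "k = q z"
  have le: "q y \<le> k * N y" for y
  proof (cases "N y = 0")
    case True
    hence "y i = 0" if "i < n" for i using that by (simp add: N_def sum_nonneg_eq_0_iff)
    thus ?thesis by (simp add: q_def True)
  next
    case False
    have "q y \<le> N y * k" unfolding scaled(2)[OF False] k_def
      by (intro mult_left_mono z scaled False) (simp add: N_def sum_nonneg)
    thus ?thesis by (simp add: mult.commute)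
  qed
  have "(\<Sum>j<n. a i j * z j) = k * z i" if i: "i < n" for i
  proof -
    define s where "s = (\<Sum>j<n. a i j * z j)"
    have "k * z i - s = 0"
    proof (rule quadratic_nonneg_imp_linear_coeff_0)
      fix t :: real
      \<comment> \<open>Moving \<open>z\<close> by \<open>t\<close> in coordinate \<open>i\<close>
        alone turns \<open>k * N - q \<ge> 0\<close> into a quadratic in \<open>t\<close>. Its
        constant term vanishes since \<open>N z = 1\<close> and \<open>q z = k\<close>, and its
        linear coefficient is the defect of the eigenvector equation at \<open>i\<close>.\<close>
      define d where "d j = (if j = i then t else 0)" for j
      have "N (\<lambda>j. z j + d j) = (\<Sum>j<n. (z j)\<^sup>2) + 2 * (\<Sum>j<n. d j * z j) + (\<Sum>j<n. d j * d j)"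
        by (simp add: N_def power2_eq_square algebra_simps sum.distrib sum_distrib_left)
      also have "\<dots> = 1 + 2 * t * z i + t\<^sup>2"
        using i z(1) by (simp add: d_def S_def N_def power2_eq_square if_distrib[of "\<lambda>u. u * _"] sum.delta cong: if_cong)
      finally have 1: "N (\<lambda>j. z j + d j) = 1 + 2 * t * z i + t\<^sup>2" .
      have delta: "(\<Sum>p<n. d p * f p) = t * f i" for f
        using i by (simp add: d_def if_distrib[of "\<lambda>u. u * _"] sum.delta cong: if_cong)
      have "q (\<lambda>j. z j + d j) = (\<Sum>p<n. \<Sum>r<n. z p * a p r * z r) + (\<Sum>p<n. d p * (\<Sum>r<n. a p r * z r))
         + (\<Sum>p<n. \<Sum>r<n. d r * (z p * a p r)) + (\<Sum>p<n. d p * (\<Sum>r<n. d r * a p r))"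
        by (simp add: q_def algebra_simps sum.distrib sum_distrib_left)
      also have "(\<Sum>p<n. \<Sum>r<n. d r * (z p * a p r)) = t * s"
        unfolding delta s_def sum_distrib_left by (intro sum.cong refl) (metis sym mult.commute)
      finally have 2: "q (\<lambda>j. z j + d j) = k + 2 * t * s + t\<^sup>2 * a i i"
        by (simp add: delta k_def q_def s_def power2_eq_square)
      show "0 \<le> t\<^sup>2 * (k - a i i) + 2 * t * (k * z i - s)"
        using le[of "\<lambda>j. z j + d j"] unfolding 1 2 by (simp add: algebra_simps)
    qed
    thus ?thesis by (simp add: s_def)
  qed
  moreover have "\<exists>i<n. z i \<noteq> 0"
  proof (rule ccontr)
    assume "\<not> ?thesis"
    hence "N z = 0" by (simp add: N_def)
    thus False using z(1) by (simp add: S_def)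
  qed
  ultimately have "eigenvalue (mat n n (\<lambda>(i, j). a i j)) k"
    unfolding eigenvalue_mat_iff by blast
  thus thesis using that le[of x] by (simp add: q_def N_def)
qed

section \<open>The spectral radius of a graph\<close>

definition adj :: "'a ugraph \<Rightarrow> 'a \<Rightarrow> 'a \<Rightarrow> real" where
  "adj G i j = (if {i, j} \<in> edges G then 1 else 0)"

lemma adj_commute: "adj G i j = adj G j i"
  by (simp add: adj_def insert_commute)

lemma adj_nonneg: "adj G i j \<ge> 0"
  by (simp add: adj_def)

lemma adjacency_matrix_adj: "adjacency_matrix n G = mat n n (\<lambda>(i, j). adj G i j)"
  by (simp add: adjacency_matrix_def adj_def)

lemma finite_eigenvalues_adjacency: "finite {k. eigenvalue (adjacency_matrix n G) k}"
  using card_finite_spectrum(1)[of "adjacency_matrix n G" n]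
  by (simp add: spectrum_def adjacency_matrix_def)

lemma graph_spectral_radius_ge_rayleigh:
  assumes "\<exists>i<n. x i \<noteq> 0"
  shows "(\<Sum>i<n. \<Sum>j<n. x i * adj G i j * x j) \<le> graph_spectral_radius n G * (\<Sum>i<n. (x i)\<^sup>2)"
proof -
  obtain k where k: "eigenvalue (adjacency_matrix n G) k"
    "(\<Sum>i<n. \<Sum>j<n. x i * adj G i j * x j) \<le> k * (\<Sum>i<n. (x i)\<^sup>2)"
    using symmetric_eigenvalue_ge_rayleigh[where a = "adj G", OF adj_commute assms]
    unfolding adjacency_matrix_adj by blast
  have "k \<le> graph_spectral_radius n G"
    unfolding graph_spectral_radius_def
    by (intro Max_ge finite_eigenvalues_adjacency) (simp add: k(1))
  hence "k * (\<Sum>i<n. (x i)\<^sup>2) \<le> graph_spectral_radius n G * (\<Sum>i<n. (x i)\<^sup>2)"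
    by (intro mult_right_mono sum_nonneg) auto
  thus ?thesis using k(2) by linarith
qed

lemma graph_spectral_radius_ge_average:
  assumes "n > 0"
  shows "(\<Sum>i<n. \<Sum>j<n. adj G i j) \<le> graph_spectral_radius n G * real n"
  using graph_spectral_radius_ge_rayleigh[of n "\<lambda>_. 1" G] assms by auto

lemma graph_spectral_radius_nonneg:
  assumes "n > 0"
  shows "graph_spectral_radius n G \<ge> 0"
proof -
  have "0 \<le> (\<Sum>i<n. \<Sum>j<n. adj G i j)" by (intro sum_nonneg adj_nonneg)
  also have "\<dots> \<le> graph_spectral_radius n G * real n"
    by (rule graph_spectral_radius_ge_average) fact
  finally show ?thesis using assms by (simp add: zero_le_mult_iff)
qed

lemma graph_spectral_radius_eigenfunction:
  assumes "n > 0"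
  obtains y where "\<exists>i<n. y i \<noteq> 0"
    "\<And>i. i < n \<Longrightarrow> (\<Sum>j<n. adj G i j * y j) = graph_spectral_radius n G * y i"
proof -
  obtain k where k: "eigenvalue (adjacency_matrix n G) k"
    using symmetric_eigenvalue_ge_rayleigh[where a = "adj G" and n = n and x = "\<lambda>_. 1", OF adj_commute] assms
    unfolding adjacency_matrix_adj by auto
  have "graph_spectral_radius n G \<in> {k. eigenvalue (adjacency_matrix n G) k}"
    unfolding graph_spectral_radius_def using k
    by (intro Max_in finite_eigenvalues_adjacency) auto
  thus thesis using that by (auto simp: adjacency_matrix_adj eigenvalue_mat_iff)
qed

text \<open>Absolute values of an eigenvector, with the triangle inequality. The result is only a
  one-sided substitute for a Perron vector, but upper bounds on the spectral radius need no
  more.\<close>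

lemma graph_spectral_radius_subeigenfunction:
  assumes "n > 0"
  obtains x where "\<And>i. x i \<ge> 0" "\<exists>i<n. x i > 0"
    "\<And>i. i < n \<Longrightarrow> graph_spectral_radius n G * x i \<le> (\<Sum>j<n. adj G i j * x j)"
proof -
  obtain y where y: "\<exists>i<n. y i \<noteq> 0"
    "\<And>i. i < n \<Longrightarrow> (\<Sum>j<n. adj G i j * y j) = graph_spectral_radius n G * y i"
    using graph_spectral_radius_eigenfunction[OF assms] by blast
  have "graph_spectral_radius n G * \<bar>y i\<bar> \<le> (\<Sum>j<n. adj G i j * \<bar>y j\<bar>)" if "i < n" for i
  proof -
    have "graph_spectral_radius n G * \<bar>y i\<bar> = \<bar>\<Sum>j<n. adj G i j * y j\<bar>"
      by (simp add: y(2) that abs_mult graph_spectral_radius_nonneg assms)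
    also have "\<dots> \<le> (\<Sum>j<n. \<bar>adj G i j * y j\<bar>)" by (rule sum_abs)
    finally show ?thesis by (simp add: abs_mult adj_nonneg)
  qed
  thus thesis using that[of "\<lambda>i. \<bar>y i\<bar>"] y(1) by auto
qed

section \<open>Embeddings, Turan numbers and stars\<close>

text \<open>Injective homomorphisms. For simple \<open>H\<close> they describe the same containment
  as isomorphic subgraphs, but they compose directly.\<close>

definition embeds :: "'b ugraph \<Rightarrow> 'a ugraph \<Rightarrow> bool" where
  "embeds H G \<longleftrightarrow>
     (\<exists>f. inj_on f (vertices H) \<and> f ` vertices H \<subseteq> vertices G \<and> (\<forall>e\<in>edges H. f ` e \<in> edges G))"

lemma graph_free_iff_not_embeds:
  assumes "simple_graph H"
  shows "graph_free H G \<longleftrightarrow> \<not> embeds H G"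
proof -
  have "\<exists>S. subgraph_of S G \<and> graph_isomorphic H S" if emb: "embeds H G"
  proof -
    obtain f where f: "inj_on f (vertices H)" "f ` vertices H \<subseteq> vertices G"
      "\<And>e. e \<in> edges H \<Longrightarrow> f ` e \<in> edges G"
      using emb unfolding embeds_def by blast
    let ?S = "(f ` vertices H, (`) f ` edges H)"
    have "card (f ` e) = 2 \<and> f ` e \<subseteq> f ` vertices H" if "e \<in> edges H" for e
      using that assms f(1) by (auto simp: simple_graph_def card_image inj_on_subset)
    hence "simple_graph ?S" using assms by (auto simp: simple_graph_def)
    hence "subgraph_of ?S G" using f by (auto simp: subgraph_of_def)
    moreover have "graph_isomorphic H ?S"
      using f(1) by (auto simp: graph_isomorphic_def bij_betw_def)
    ultimately show ?thesis by blast
  qed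
  moreover have "embeds H G" if S: "subgraph_of S G" "graph_isomorphic H S" for S
  proof -
    obtain f where f: "inj_on f (vertices H)" "f ` vertices H = vertices S"
        "edges S = (`) f ` edges H"
      using S(2) unfolding graph_isomorphic_def bij_betw_def by blast
    have "f ` e \<in> edges G" if "e \<in> edges H" for e
      using S(1) f(3) that by (auto simp: subgraph_of_def)
    thus ?thesis using S(1) f unfolding embeds_def subgraph_of_def by metis
  qed
  ultimately show ?thesis by (auto simp: graph_free_def)
qed

lemma embeds_trans:
  assumes "simple_graph H" "embeds H G" "embeds G K"
  shows "embeds H K"
proof -
  obtain f where f: "inj_on f (vertices H)" "f ` vertices H \<subseteq> vertices G"
      "\<And>e. e \<in> edges H \<Longrightarrow> f ` e \<in> edges G"
    using assms(2) unfolding embeds_def by blast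
  obtain g where g: "inj_on g (vertices G)" "g ` vertices G \<subseteq> vertices K"
      "\<And>e. e \<in> edges G \<Longrightarrow> g ` e \<in> edges K"
    using assms(3) unfolding embeds_def by blast
  have "inj_on (g \<circ> f) (vertices H)"
    using f g by (meson comp_inj_on inj_on_subset)
  moreover have "(g \<circ> f) ` vertices H \<subseteq> vertices K" using f(2) g(2) by fastforce
  moreover have "(g \<circ> f) ` e \<in> edges K" if "e \<in> edges H" for e
    using g(3)[OF f(3)[OF that]] by (simp add: image_comp)
  ultimately show ?thesis unfolding embeds_def by blast
qed

section \<open>Extremal numbers and edge counts\<close>

lemma finite_edges: "simple_graph G \<Longrightarrow> finite (edges G)"
  by (rule finite_subset[of _ "Pow (vertices G)"]) (auto simp: simple_graph_def)

lemma finite_free_graphs: "finite (free_graphs n H)"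
proof (rule finite_subset)
  show "free_graphs n H \<subseteq> {{..<n}} \<times> Pow (Pow {..<n})"
    by (force simp: free_graphs_def simple_graph_def)
qed auto

lemma card_edges_le_ex_num: "G \<in> free_graphs n H \<Longrightarrow> card (edges G) \<le> ex_num n H"
  by (auto simp: ex_num_def finite_free_graphs)

lemma ex_num_attained:
  assumes "ex_num n H > 0"
  obtains G where "G \<in> free_graphs n H" "card (edges G) = ex_num n H"
proof -
  have ne: "free_graphs n H \<noteq> {}" using assms by (auto simp: ex_num_def)
  hence "ex_num n H = Max ((\<lambda>G. card (edges G)) ` free_graphs n H)" by (simp add: ex_num_def)
  also have "\<dots> \<in> (\<lambda>G. card (edges G)) ` free_graphs n H"
    using ne by (intro Max_in) (auto simp: finite_free_graphs)
  finally have "ex_num n H \<in> (\<lambda>G. card (edges G)) ` free_graphs n H" .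
  thus thesis using that by auto
qed

text \<open>Lets a bound \<open>C * real n powr p\<close> hold at \<open>n = 0\<close> too, where
  the power is 0.\<close>

lemma ex_num_0: "ex_num 0 H = 0"
proof (rule ccontr)
  assume "\<not> ?thesis"
  then obtain G where G: "G \<in> free_graphs 0 H" "card (edges G) \<noteq> 0"
    by (metis ex_num_attained gr0I)
  hence "edges G = {}" by (force simp: free_graphs_def simple_graph_def)
  thus False using G(2) by simp
qed

lemma graph_spectral_radius_le_spex_num:
  "G \<in> free_graphs n H \<Longrightarrow> graph_spectral_radius n G \<le> spex_num n H"
  by (auto simp: spex_num_def finite_free_graphs)

text \<open>The condition \<open>c \<ge> 0\<close> covers an empty family, where
  \<open>spex_num\<close> is 0 by convention.\<close>

lemma spex_num_le:
  assumes "\<And>G. G \<in> free_graphs n H \<Longrightarrow> graph_spectral_radius n G \<le> c" "c \<ge> 0"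
  shows "spex_num n H \<le> c"
  using assms by (auto simp: spex_num_def finite_free_graphs)

lemma spex_num_nonneg:
  assumes "n > 0"
  shows "spex_num n H \<ge> 0"
proof (cases "free_graphs n H = {}")
  case False
  then obtain G where "G \<in> free_graphs n H" by blast
  thus ?thesis
    using graph_spectral_radius_nonneg[OF assms, of G] graph_spectral_radius_le_spex_num
    by (meson order_trans)
qed (simp add: spex_num_def)

text \<open>Double counting: every edge inside \<open>U\<close> arises from exactly two ordered
  pairs, collected in \<open>P\<close>.\<close>

lemma sum_adj_eq_card_edges:
  assumes "simple_graph G" "finite U"
  shows "(\<Sum>i\<in>U. \<Sum>j\<in>U. adj G i j) = 2 * real (card {e \<in> edges G. e \<subseteq> U})"
proof -
  define P where "P = {p \<in> U \<times> U. {fst p, snd p} \<in> edges G}"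
  define F where "F = {e \<in> edges G. e \<subseteq> U}"
  have fin: "finite P" "finite F"
    using assms finite_edges by (auto simp: P_def F_def)
  have two: "card {p \<in> P. {fst p, snd p} = e} = 2" if "e \<in> F" for e
  proof -
    have "card e = 2" using that assms(1) by (auto simp: F_def simple_graph_def)
    then obtain u v where uv: "e = {u, v}" "u \<noteq> v" by (auto simp: card_2_iff)
    have "{p \<in> P. {fst p, snd p} = e} = {(u, v), (v, u)}"
      using that by (auto simp: P_def F_def uv(1) doubleton_eq_iff insert_commute)
    thus ?thesis using uv(2) by simp
  qed
  have "(\<Sum>i\<in>U. \<Sum>j\<in>U. adj G i j) = (\<Sum>p\<in>U \<times> U. if {fst p, snd p} \<in> edges G then 1 else 0)"
    by (simp add: sum.cartesian_product adj_def case_prod_beta)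
  also have "\<dots> = real (card P)"
    using assms(2) by (simp add: P_def sum.If_cases Int_def)
  also have "card P = (\<Sum>e\<in>F. card {p \<in> P. {fst p, snd p} = e})"
    using sum.group[OF fin, of "\<lambda>p. {fst p, snd p}" "\<lambda>_. 1 :: nat"]
    by (force simp: P_def F_def)
  also have "\<dots> = 2 * card F" by (simp add: two)
  finally show ?thesis by (simp add: F_def)
qed

text \<open>Relabelling \<open>U\<close> by an initial segment of the naturals gives a graph that
  embeds into \<open>G\<close>, so a copy of \<open>H\<close> in it would be one in
  \<open>G\<close>.\<close>

lemma card_induced_edges_le_ex_num:
  assumes H: "simple_graph H" and G: "G \<in> free_graphs n H" and U: "U \<subseteq> {..<n}"
  shows "card {e \<in> edges G. e \<subseteq> U} \<le> ex_num (card U) H"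
proof -
  have sG: "simple_graph G" "vertices G = {..<n}" "\<not> embeds H G"
    using G by (auto simp: free_graphs_def graph_free_iff_not_embeds[OF H])
  have "finite U" using U finite_subset by blast
  then obtain g where g: "bij_betw g {..<card U} U"
    using ex_bij_betw_nat_finite[of U] by (auto simp: atLeast0LessThan)
  define G' where "G' = ({..<card U}, {e. e \<subseteq> {..<card U} \<and> g ` e \<in> edges G})"
  have card_g: "card (g ` e) = card e" if "e \<subseteq> {..<card U}" for e
    using g that by (meson bij_betw_def card_image inj_on_subset)
  have sG': "simple_graph G'"
    using sG(1) card_g by (auto simp: simple_graph_def G'_def)
  have "embeds G' G"
    unfolding embeds_def using g U sG(2) by (intro exI[of _ g]) (auto simp: G'_def bij_betw_def)
  hence "\<not> embeds H G'" using embeds_trans[OF H] sG(3) by blast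
  hence "G' \<in> free_graphs (card U) H"
    using sG' by (simp add: free_graphs_def graph_free_iff_not_embeds[OF H]) (simp add: G'_def)
  hence "card (edges G') \<le> ex_num (card U) H" by (rule card_edges_le_ex_num)
  moreover have "{e \<in> edges G. e \<subseteq> U} \<subseteq> (`) g ` edges G'"
  proof
    fix e assume e: "e \<in> {e \<in> edges G. e \<subseteq> U}"
    then obtain e' where "e' \<subseteq> {..<card U}" "e = g ` e'"
      using g by (metis (no_types, lifting) bij_betw_imp_surj_on mem_Collect_eq subset_imageE)
    thus "e \<in> (`) g ` edges G'" using e by (auto simp: G'_def)
  qed
  hence "card {e \<in> edges G. e \<subseteq> U} \<le> card (edges G')"
    using finite_edges[OF sG'] by (meson card_image_le card_mono finite_imageI order_trans)
  ultimately show ?thesis by linarith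
qed

text \<open>The all-ones test vector bounds the spectral radius of an edge-maximal graph below by
  its average degree.\<close>

lemma average_degree_le_spex_num:
  assumes "n > 0"
  shows "2 * real (ex_num n H) \<le> spex_num n H * real n"
\<comment> \<open>With \<open>ex_num n H = 0\<close> the family may be empty and offer no graph to
  test; nonnegativity suffices there.\<close>
proof (cases "ex_num n H = 0")
  case True
  thus ?thesis by (simp add: spex_num_nonneg assms)
next
  case False
  then obtain G where G: "G \<in> free_graphs n H" "card (edges G) = ex_num n H"
    using ex_num_attained[of n H] by auto
  hence sG: "simple_graph G" "vertices G = {..<n}" by (auto simp: free_graphs_def)
  hence "{e \<in> edges G. e \<subseteq> {..<n}} = edges G" by (auto simp: simple_graph_def)
  hence "2 * real (ex_num n H) = (\<Sum>i<n. \<Sum>j<n. adj G i j)"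
    using sum_adj_eq_card_edges[OF sG(1), of "{..<n}"] G(2) by simp
  also have "\<dots> \<le> graph_spectral_radius n G * real n"
    by (rule graph_spectral_radius_ge_average) fact
  also have "\<dots> \<le> spex_num n H * real n"
    by (intro mult_right_mono graph_spectral_radius_le_spex_num G) auto
  finally show ?thesis .
qed

section \<open>Stars and bounded degree\<close>

definition star_graph :: "nat \<Rightarrow> nat ugraph" where
  "star_graph n = ({..<n}, {{0, i} | i. 0 < i \<and> i < n})"

lemma simple_star_graph: "simple_graph (star_graph n)"
  by (auto simp: simple_graph_def star_graph_def)

lemma star_spectral_radius_ge:
  assumes "n > 0"
  shows "sqrt (real n - 1) \<le> graph_spectral_radius n (star_graph n)"
\<comment> \<open>Setting the single vertex aside makes \<open>r\<close> positive, so that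
  \<open>2 * r^2\<close> can be cancelled at the end.\<close>
proof (cases "n = 1")
  case True
  thus ?thesis using graph_spectral_radius_nonneg[of n "star_graph n"] by simp
next
  case False
  define r where "r = sqrt (real n - 1)"
  have n: "n \<ge> 2" using False assms by simp
  hence r: "r > 0" "r\<^sup>2 = real n - 1" by (auto simp: r_def)
  have adj: "adj (star_graph n) i j = (if (i = 0) \<noteq> (j = 0) then 1 else 0)" if "i < n" "j < n" for i j
    using that by (auto simp: adj_def star_graph_def doubleton_eq_iff)
  \<comment> \<open>The eigenvector of the star for the eigenvalue \<open>r\<close>. The centre
    contributes as much to the squared norm as all leaves together.\<close>
  define x where "x i = (if i = 0 then r else 1)" for i :: nat
  have split0: "(\<Sum>i<n. f i) = f 0 + (\<Sum>i\<in>{1..<n}. f i)" for f :: "nat \<Rightarrow> real"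
    using sum.atLeast_Suc_lessThan[of 0 n f] assms by (simp add: atLeast0LessThan)
  have "(\<Sum>j<n. x i * adj (star_graph n) i j * x j) = (if i = 0 then r * r\<^sup>2 else r)" if "i < n" for i
  proof -
    have "(\<Sum>j<n. x i * adj (star_graph n) i j * x j) =
        (\<Sum>j<n. x i * (if (i = 0) \<noteq> (j = 0) then 1 else 0) * x j)"
      using that by (intro sum.cong) (auto simp: adj)
    also have "\<dots> = (if i = 0 then r * r\<^sup>2 else r)"
      using n unfolding split0 r(2) by (auto simp: x_def of_nat_diff)
    finally show ?thesis .
  qed
  hence "(\<Sum>i<n. \<Sum>j<n. x i * adj (star_graph n) i j * x j) = (\<Sum>i<n. if i = 0 then r * r\<^sup>2 else r)"
    by simp
  also have "\<dots> = r * (2 * r\<^sup>2)"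
    using n unfolding split0 by (simp add: r(2) of_nat_diff algebra_simps)
  finally have q: "(\<Sum>i<n. \<Sum>j<n. x i * adj (star_graph n) i j * x j) = r * (2 * r\<^sup>2)" .
  have "(\<Sum>i<n. (x i)\<^sup>2) = 2 * r\<^sup>2"
    using n unfolding split0 by (simp add: x_def r(2) of_nat_diff)
  moreover have "\<exists>i<n. x i \<noteq> 0" using assms r(1) by (auto simp: x_def)
  ultimately have "r * (2 * r\<^sup>2) \<le> graph_spectral_radius n (star_graph n) * (2 * r\<^sup>2)"
    using graph_spectral_radius_ge_rayleigh[of n x "star_graph n"] q by simp
  thus ?thesis using r(1) by (simp add: r_def[symmetric])
qed

lemma sqrt_le_spex_num:
  assumes "n > 0" "simple_graph H" "\<not> embeds H (star_graph n)"
  shows "sqrt (real n - 1) \<le> spex_num n H"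
proof -
  have "star_graph n \<in> free_graphs n H"
    using assms simple_star_graph
    by (simp add: free_graphs_def graph_free_iff_not_embeds) (simp add: star_graph_def)
  thus ?thesis using graph_spectral_radius_le_spex_num star_spectral_radius_ge[OF assms(1)]
    by (meson order_trans)
qed

text \<open>Evaluate the subeigenfunction at a vertex where it is largest: every neighbour
  contributes at most the same value \<open>m\<close>.\<close>

lemma graph_spectral_radius_le_max_degree:
  assumes n: "n > 0" and deg: "\<And>i. i < n \<Longrightarrow> (\<Sum>j<n. adj G i j) \<le> d"
  shows "graph_spectral_radius n G \<le> d"
proof -
  obtain x where x: "\<And>i. x i \<ge> 0" "\<exists>i<n. x i > 0"
    "\<And>i. i < n \<Longrightarrow> graph_spectral_radius n G * x i \<le> (\<Sum>j<n. adj G i j * x j)"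
    using graph_spectral_radius_subeigenfunction[OF n] by blast
  define m where "m = Max (x ` {..<n})"
  have "m \<in> x ` {..<n}" unfolding m_def using n by (intro Max_in) auto
  then obtain i where i: "i < n" "x i = m" by auto
  have le: "x j \<le> m" if "j < n" for j using that by (simp add: m_def)
  have m: "m > 0" using x(2) le by (meson less_le_trans)
  have "graph_spectral_radius n G * m \<le> (\<Sum>j<n. adj G i j * x j)" using x(3) i by auto
  also have "\<dots> \<le> (\<Sum>j<n. adj G i j * m)"
    by (intro sum_mono mult_left_mono adj_nonneg le) auto
  also have "\<dots> = (\<Sum>j<n. adj G i j) * m" by (simp add: sum_distrib_right)
  also have "\<dots> \<le> d * m" using deg[OF i(1)] m by (intro mult_right_mono) auto
  finally show ?thesis using m by simp
qed

lemma embeds_star_graph: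
  assumes G: "simple_graph G" "v \<in> vertices G" and m: "m > 0"
    and deg: "m \<le> card {j. {v, j} \<in> edges G}"
  shows "embeds (star_graph m) G"
proof -
  let ?N = "{j. {v, j} \<in> edges G}"
  have N: "?N \<subseteq> vertices G" "v \<notin> ?N" using G(1) by (force simp: simple_graph_def)+
  hence "finite ?N" using G(1) finite_subset by (auto simp: simple_graph_def)
  then obtain g where g: "bij_betw g {..<card ?N} ?N"
    using ex_bij_betw_nat_finite[of ?N] by (auto simp: atLeast0LessThan)
  \<comment> \<open>\<open>star_graph m\<close> has \<open>m - 1\<close> leaves, so \<open>m\<close>
    neighbours leave one to spare and leaf \<open>i\<close> can go to \<open>g i\<close> without a
    shift of indices.\<close>
  define f where "f i = (if i = 0 then v else g i)" for i
  have gN: "g i \<in> ?N" if "i < m" for i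
    using bij_betwE[OF g] that deg by auto
  have "inj_on g {..<m}" using g deg by (auto simp: bij_betw_def intro: inj_on_subset)
  moreover have "g i \<noteq> v" if "i < m" for i using gN[OF that] N(2) by metis
  ultimately have "inj_on f {..<m}" by (auto simp: inj_on_def f_def)
  moreover have "f ` {..<m} \<subseteq> vertices G" using gN N(1) G(2) by (auto simp: f_def)
  moreover have "f ` {0, i} \<in> edges G" if "0 < i" "i < m" for i
    using gN[OF that(2)] that by (simp add: f_def insert_commute)
  ultimately show ?thesis unfolding embeds_def by (auto simp: star_graph_def)
qed

text \<open>A vertex of degree at least \<open>m\<close> would carry the star and hence
  \<open>H\<close>, so degrees are bounded independently of \<open>n\<close>.\<close>

lemma spex_num_le_of_embeds_star:
  assumes H: "simple_graph H" and m: "m > 0" "embeds H (star_graph m)" and n: "n > 0"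
  shows "spex_num n H \<le> real m"
proof (rule spex_num_le)
  fix G assume "G \<in> free_graphs n H"
  hence G: "simple_graph G" "vertices G = {..<n}" "\<not> embeds H G"
    by (auto simp: free_graphs_def graph_free_iff_not_embeds[OF H])
  show "graph_spectral_radius n G \<le> real m"
  proof (rule graph_spectral_radius_le_max_degree[OF n])
    fix i assume i: "i < n"
    have "{j. {i, j} \<in> edges G} = {..<n} \<inter> {j. {i, j} \<in> edges G}"
      using G(1,2) by (force simp: simple_graph_def)
    hence "(\<Sum>j<n. adj G i j) = real (card {j. {i, j} \<in> edges G})"
      by (simp add: adj_def sum.If_cases)
    also have "\<dots> \<le> real m"
      using embeds_star_graph[OF G(1) _ m(1), of i] i G embeds_trans[OF H m(2)]
      by (metis lessThan_iff linorder_linear of_nat_le_iff)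
    finally show "(\<Sum>j<n. adj G i j) \<le> real m" .
  qed
qed simp

section \<open>Eigenvalues of locally sparse weights\<close>

text \<open>The elements whose weight exceeds twice the average allowed on \<open>T\<close> make up at most half
  of \<open>T\<close>; iterating on them gives a geometric series.\<close>

lemma sum_mult_le_of_sublinear_sums:
  fixes w x :: "'a \<Rightarrow> real"
  assumes s: "s > 1 / 2" and K: "K \<ge> 0" and M: "M \<ge> 0"
    and "finite T"
    and "\<And>i. i \<in> T \<Longrightarrow> w i \<ge> 0" and "\<And>i. i \<in> T \<Longrightarrow> x i \<ge> 0"
    and "\<And>B. B \<subseteq> T \<Longrightarrow> sum w B \<le> K * real (card B) powr s"
    and "\<And>B. B \<subseteq> T \<Longrightarrow> sum x B \<le> M * real (card B) powr s"
  shows "(\<Sum>i\<in>T. w i * x i) \<le> 2 / (1 - 2 powr (1 - 2 * s)) * K * M * real (card T) powr (2 * s - 1)"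
  using assms(4-)
proof (induction "card T" arbitrary: T rule: less_induct)
  case less
  show ?case
  proof (cases "T = {}")
    case False
    define t where "t = real (card T)"
    have t: "t > 0" using False less.prems(1) by (simp add: t_def card_gt_0_iff)
    \<comment> \<open>With \<open>q = 2 powr (1 - 2 * s)\<close>, \<open>c\<close> is the geometric
      series \<open>2 * (1 + q + q^2 + ...)\<close> and solves \<open>c * q + 2 = c\<close>: the
      elements of small weight cost 2, and the recursion on at most half of \<open>T\<close> costs
      \<open>c * q\<close>.\<close>
    define c where "c = 2 / (1 - 2 powr (1 - 2 * s))"
    have "2 powr (1 - 2 * s) < 2 powr 0" using s by (intro powr_less_mono) auto
    hence p: "1 - 2 powr (1 - 2 * s) > 0" by simp
    hence "c \<ge> 0" by (simp add: c_def)
    have "c * (1 - 2 powr (1 - 2 * s)) = 2"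
      by (rule iffD1[OF nonzero_eq_divide_eq]) (use p in \<open>auto simp: c_def\<close>)
    hence c_eq: "c * 2 powr (1 - 2 * s) + 2 = c" by (simp add: algebra_simps)
    define T' where "T' = {i \<in> T. w i > 2 * K * t powr (s - 1)}"
    have sub: "T' \<subseteq> T" by (auto simp: T'_def)
    hence fin: "finite T'" using less.prems(1) finite_subset by blast
    have half: "real (card T') \<le> t / 2 \<or> T' = {}"
    proof (cases "T' = {}")
      case ne: False
      have "(\<Sum>i\<in>T'. 2 * K * t powr (s - 1)) < sum w T'"
        using fin ne by (rule sum_strict_mono) (simp add: T'_def)
      also have "\<dots> \<le> sum w T" using sub less.prems by (intro sum_mono2) auto
      also have "\<dots> \<le> K * t powr s" using less.prems(4)[of T] by (simp add: t_def)
      also have "t powr s = t * t powr (s - 1)" using t by (simp add: powr_diff)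
      finally have "(K * t powr (s - 1)) * (2 * real (card T')) < (K * t powr (s - 1)) * t"
        by (simp add: mult_ac)
      hence "2 * real (card T') < t"
        by (rule mult_left_less_imp_less) (simp add: K)
      thus ?thesis by simp
    qed simp
    have card_half: "real (card T') \<le> t / 2" using half t by auto
    hence "card T' < card T" using t by (simp add: t_def)
    hence "(\<Sum>i\<in>T'. w i * x i) \<le> c * K * M * real (card T') powr (2 * s - 1)"
      unfolding c_def using sub fin by (intro less.hyps less.prems) auto
    also have "\<dots> \<le> c * K * M * (t / 2) powr (2 * s - 1)"
      using \<open>c \<ge> 0\<close> K M s card_half by (intro mult_left_mono powr_mono2) auto
    also have "(t / 2) powr (2 * s - 1) = 2 powr (1 - 2 * s) * t powr (2 * s - 1)"
      using t by (simp add: powr_divide powr_minus_divide[symmetric])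
        (simp add: powr_minus[symmetric] divide_inverse mult.commute)
    finally have 1: "(\<Sum>i\<in>T'. w i * x i) \<le> c * K * M * (2 powr (1 - 2 * s) * t powr (2 * s - 1))" .
    have "(\<Sum>i\<in>T - T'. w i * x i) \<le> (\<Sum>i\<in>T - T'. 2 * K * t powr (s - 1) * x i)"
      using less.prems(3) by (intro sum_mono mult_right_mono) (auto simp: T'_def)
    also have "\<dots> = 2 * K * t powr (s - 1) * sum x (T - T')" by (simp add: sum_distrib_left)
    also have "\<dots> \<le> 2 * K * t powr (s - 1) * (M * t powr s)"
    proof (intro mult_left_mono)
      have "sum x (T - T') \<le> sum x T" using less.prems by (intro sum_mono2) auto
      thus "sum x (T - T') \<le> M * t powr s" using less.prems(5)[of T] by (simp add: t_def)
    qed (use K in auto)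
    also have "\<dots> = K * M * t powr (2 * s - 1) * 2"
      using powr_add[of t "s - 1" s] by (simp add: algebra_simps)
    finally have 2: "(\<Sum>i\<in>T - T'. w i * x i) \<le> K * M * t powr (2 * s - 1) * 2" .
    have "(\<Sum>i\<in>T. w i * x i) = (\<Sum>i\<in>T - T'. w i * x i) + (\<Sum>i\<in>T'. w i * x i)"
      using sub less.prems(1) by (rule sum.subset_diff)
    also have "\<dots> \<le> K * M * t powr (2 * s - 1) * (c * 2 powr (1 - 2 * s) + 2)"
      using 1 2 by (simp add: algebra_simps)
    finally show ?thesis unfolding c_eq by (simp add: c_def t_def mult_ac)
  qed simp
qed

text \<open>Cut \<open>B\<close> into pieces no larger than \<open>A\<close>. Each costs at most
  \<open>K * k powr (1 + s)\<close> with \<open>k = card A\<close>, and about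
  \<open>card B / k + 1\<close> pieces are enough. \<open>A\<close> and \<open>B\<close> may
  overlap, and either may be the larger, so the bound can be used in both orders.\<close>

lemma bipartite_weight_bound:
  fixes a :: "nat \<Rightarrow> nat \<Rightarrow> real"
  assumes nonneg: "\<And>i j. a i j \<ge> 0" and D: "D \<ge> 0" and s: "s \<ge> 0"
    and dens: "\<And>U. U \<subseteq> {..<n} \<Longrightarrow> (\<Sum>i\<in>U. \<Sum>j\<in>U. a i j) \<le> D * real (card U) powr (1 + s)"
    and A: "A \<subseteq> {..<n}" and B: "B \<subseteq> {..<n}"
  shows "(\<Sum>i\<in>A. \<Sum>j\<in>B. a i j) \<le>
    D * 2 powr (1 + s) * (real (card A) + real (card B)) * real (card A) powr s"
  using B
proof (induction "card B" arbitrary: B rule: less_induct)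
  case less
  define K where "K = D * 2 powr (1 + s)"
  have K: "K \<ge> 0" using D by (simp add: K_def)
  have finA: "finite A" and finB: "finite B" using A less.prems finite_subset by blast+
  define k where "k = real (card A)"
  \<comment> \<open>By nonnegativity the block \<open>A \<times> C\<close> may be enlarged to the
    square on \<open>A \<union> C\<close>, which has at most \<open>2 * k\<close> elements and falls
    under \<open>dens\<close>.\<close>
  have small: "(\<Sum>i\<in>A. \<Sum>j\<in>C. a i j) \<le> K * k * k powr s" if "C \<subseteq> B" "card C \<le> card A" for C
  proof -
    have finC: "finite C" using that finB finite_subset by blast
    have "(\<Sum>i\<in>A. \<Sum>j\<in>C. a i j) \<le> (\<Sum>i\<in>A. \<Sum>j\<in>A \<union> C. a i j)"
      using finA finC nonneg by (intro sum_mono sum_mono2) auto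
    also have "\<dots> \<le> (\<Sum>i\<in>A \<union> C. \<Sum>j\<in>A \<union> C. a i j)"
      using finA finC nonneg by (intro sum_mono2 sum_nonneg) auto
    also have "\<dots> \<le> D * real (card (A \<union> C)) powr (1 + s)"
      using A that less.prems by (intro dens) auto
    also have "\<dots> \<le> D * (2 * k) powr (1 + s)"
    proof (intro mult_left_mono powr_mono2 D)
      have "card (A \<union> C) \<le> 2 * card A" using card_Un_le[of A C] that(2) by linarith
      thus "real (card (A \<union> C)) \<le> 2 * k" by (simp add: k_def)
    qed (use s in auto)
    also have "\<dots> = K * k * k powr s"
      by (cases "k = 0") (simp_all add: K_def k_def powr_mult powr_add)
    finally show ?thesis .
  qed
  have "(\<Sum>i\<in>A. \<Sum>j\<in>B. a i j) \<le> K * (k + real (card B)) * k powr s"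
  proof (cases "card B \<le> card A \<or> A = {}")
    case True
    thus ?thesis
    proof
      assume "card B \<le> card A"
      hence "(\<Sum>i\<in>A. \<Sum>j\<in>B. a i j) \<le> K * k * k powr s" by (intro small) auto
      also have "\<dots> \<le> K * (k + real (card B)) * k powr s"
        using K by (intro mult_right_mono mult_left_mono) auto
      finally show ?thesis .
    qed (use K in \<open>simp add: k_def\<close>)
  next
    case False
    hence *: "card A < card B" "card A > 0" using finA by (auto simp: card_gt_0_iff)
    then obtain C where C: "C \<subseteq> B" "card C = card A"
      using obtain_subset_with_card_n[of "card A" B] by auto
    have finC: "finite C" using C finB finite_subset by blast
    have card_diff: "card (B - C) = card B - card A" using C finC by (simp add: card_Diff_subset)
    \<comment> \<open>Removing \<open>C\<close> lowers the claimed bound by exactly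
      \<open>K * k * k powr s\<close>, the price of \<open>C\<close> given by
      \<open>small\<close>.\<close>
    have "(\<Sum>i\<in>A. \<Sum>j\<in>B. a i j) = (\<Sum>i\<in>A. \<Sum>j\<in>B - C. a i j) + (\<Sum>i\<in>A. \<Sum>j\<in>C. a i j)"
      using C(1) finB by (simp add: sum.subset_diff[of C B] sum.distrib)
    also have "\<dots> \<le> K * (k + real (card (B - C))) * k powr s + K * k * k powr s"
      unfolding K_def k_def using less.prems * C(2) card_diff
      by (intro add_mono less.hyps small[OF C(1), unfolded K_def k_def]) auto
    also have "\<dots> = K * (k + real (card B)) * k powr s"
      using * by (simp add: card_diff k_def of_nat_diff algebra_simps)
    finally show ?thesis .
  qed
  thus ?case by (simp add: K_def k_def)
qed

text \<open>Summing \<open>sub\<close> over a well-chosen set \<open>A\<close> gives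
  \<open>r * x(A) \<le> (\<Sum>j<n. d j * x j)\<close>, where \<open>d j\<close> is the weight
  between \<open>j\<close> and \<open>A\<close>. Light and heavy vertices are each shown to
  contribute a constant times \<open>n powr s * x(A)\<close>.\<close>

lemma subeigenvalue_bound_of_sparse:
  fixes a :: "nat \<Rightarrow> nat \<Rightarrow> real"
  assumes sym: "\<And>i j. a i j = a j i" and nonneg: "\<And>i j. a i j \<ge> 0"
    and D: "D \<ge> 0" and s: "s > 1 / 2"
    and dens: "\<And>U. U \<subseteq> {..<n} \<Longrightarrow> (\<Sum>i\<in>U. \<Sum>j\<in>U. a i j) \<le> D * real (card U) powr (1 + s)"
    and x: "\<And>i. x i \<ge> 0" "\<exists>i<n. x i > 0"
    and sub: "\<And>i. i < n \<Longrightarrow> r * x i \<le> (\<Sum>j<n. a i j * x j)"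
  shows "r \<le> 2 * (D * 2 powr (1 + s)) * (1 + 2 / (1 - 2 powr (1 - 2 * s))) * real n powr s"
proof -
  define K where "K = D * 2 powr (1 + s)"
  define c where "c = 2 / (1 - 2 powr (1 - 2 * s))"
  have K: "K \<ge> 0" using D by (simp add: K_def)
  have "2 powr (1 - 2 * s) < 2 powr 0" using s by (intro powr_less_mono) auto
  hence c: "c \<ge> 0" by (simp add: c_def)
  define S where "S = {A. A \<subseteq> {..<n} \<and> A \<noteq> {}}"
  \<comment> \<open>Normalising by \<open>card A powr s\<close> gives every \<open>B\<close> the
    bound \<open>sum x B \<le> M * card B powr s\<close>, with equality at the maximiser
    \<open>A\<close>. This is the sublinear growth of \<open>x\<close> that the geometric series
    requires.\<close>
  define M where "M = Max ((\<lambda>A. sum x A / real (card A) powr s) ` S)"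
  obtain i0 where i0: "i0 < n" "x i0 > 0" using x(2) by blast
  have finS: "finite S" by (simp add: S_def)
  moreover have "{i0} \<in> S" using i0 by (simp add: S_def)
  ultimately have "M \<in> (\<lambda>A. sum x A / real (card A) powr s) ` S"
    unfolding M_def by (intro Max_in) auto
  then obtain A where A: "A \<in> S" "M = sum x A / real (card A) powr s" by blast
  have Mle: "sum x B / real (card B) powr s \<le> M" if "B \<in> S" for B
    unfolding M_def using that finS by (intro Max_ge) auto
  have "M > 0" using Mle[OF \<open>{i0} \<in> S\<close>] i0(2) by simp
  have le_M: "sum x B \<le> M * real (card B) powr s" if "B \<subseteq> {..<n}" for B
  proof (cases "B = {}")
    case False
    have "card B > 0" using that False finite_subset by (auto simp: card_gt_0_iff)
    thus ?thesis using Mle[of B] that False by (simp add: S_def divide_le_eq)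
  qed simp
  define k where "k = real (card A)"
  have AV: "A \<subseteq> {..<n}" "A \<noteq> {}" using A(1) by (auto simp: S_def)
  have "finite A" using AV finite_subset by blast
  hence k: "k > 0" using AV by (simp add: k_def card_gt_0_iff)
  have kn: "k \<le> real n" using card_mono[of "{..<n}" A] AV by (simp add: k_def)
  have xA: "sum x A = M * k powr s" using k by (simp add: A(2) k_def)
  define d where "d j = (\<Sum>i\<in>A. a i j)" for j
  have d_nonneg: "d j \<ge> 0" for j by (simp add: d_def sum_nonneg nonneg)
  have sum_d: "sum d B = (\<Sum>i\<in>A. \<Sum>j\<in>B. a i j)" for B
    unfolding d_def by (rule sum.swap)
  \<comment> \<open>The same estimate in both orders: \<open>d1\<close>, with the power on
    \<open>card A\<close>, limits the number of heavy vertices; \<open>d2\<close>, with the power on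
    \<open>card B\<close>, gives the sublinear growth of \<open>d\<close>.\<close>
  have d1: "sum d B \<le> K * (k + real (card B)) * k powr s" if "B \<subseteq> {..<n}" for B
    using bipartite_weight_bound[of a D s n A B] nonneg D s dens AV that
    by (simp add: sum_d K_def k_def)
  have d2: "sum d B \<le> K * (k + real (card B)) * real (card B) powr s" if "B \<subseteq> {..<n}" for B
  proof -
    have "sum d B = (\<Sum>j\<in>B. \<Sum>i\<in>A. a j i)" unfolding d_def using sym by (intro sum.cong) auto
    thus ?thesis
      using bipartite_weight_bound[of a D s n B A] nonneg D s dens AV that
      by (simp add: K_def k_def add.commute)
  qed
  \<comment> \<open>The heavy vertices. The threshold is chosen so that \<open>d1\<close> yields
    \<open>2 * card T < k + card T\<close> when \<open>T\<close> is nonempty, hence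
    \<open>card T \<le> k\<close>.\<close>
  define T where "T = {j. j < n \<and> d j > 2 * K * k powr s}"
  have T: "T \<subseteq> {..<n}" "finite T" by (auto simp: T_def)
  have Tk: "real (card T) \<le> k"
  proof (cases "T = {}")
    case False
    have "(\<Sum>j\<in>T. 2 * K * k powr s) < sum d T"
      using T(2) False by (rule sum_strict_mono) (simp add: T_def)
    also have "\<dots> \<le> K * (k + real (card T)) * k powr s" by (intro d1 T)
    finally have "(K * k powr s) * (2 * real (card T)) < (K * k powr s) * (k + real (card T))"
      by (simp add: mult_ac)
    hence "2 * real (card T) < k + real (card T)"
      by (rule mult_left_less_imp_less) (simp add: K)
    thus ?thesis by simp
  qed (use k in simp)
  \<comment> \<open>Subsets of \<open>T\<close> have at most \<open>k\<close> elements, so the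
    factor \<open>k + card B\<close> in \<open>d2\<close> is at most \<open>2 * k\<close>; this
    explains the constant \<open>2 * K * k\<close>.\<close>
  have "(\<Sum>j\<in>T. d j * x j) \<le> c * (2 * K * k) * M * real (card T) powr (2 * s - 1)"
    unfolding c_def
  proof (rule sum_mult_le_of_sublinear_sums[OF s])
    fix B assume B: "B \<subseteq> T"
    have "real (card B) \<le> k" using card_mono[OF T(2) B] Tk by linarith
    hence "K * (k + real (card B)) * real (card B) powr s \<le> K * (k + k) * real (card B) powr s"
      using K by (intro mult_right_mono mult_left_mono) auto
    thus "sum d B \<le> 2 * K * k * real (card B) powr s"
      using d2[OF subset_trans[OF B T(1)]] by (simp add: algebra_simps)
    show "sum x B \<le> M * real (card B) powr s" using B T by (intro le_M) auto
  qed (use K k \<open>M > 0\<close> T d_nonneg x in auto)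
  also have "\<dots> \<le> c * (2 * K * k) * M * k powr (2 * s - 1)"
    using c K k \<open>M > 0\<close> Tk s by (intro mult_left_mono powr_mono2) auto
  \<comment> \<open>One factor \<open>k powr s\<close> joins \<open>M\<close> to form
    \<open>x(A)\<close>; the other is then bounded by \<open>n powr s\<close>.\<close>
  also have "\<dots> = M * k powr s * (2 * K * c) * k powr s"
  proof -
    have "k * k powr (2 * s - 1) = k powr s * k powr s"
      using k powr_mult_base[of k "2 * s - 1"] by (simp add: powr_add[symmetric])
    thus ?thesis by (metis (no_types, opaque_lifting) mult.assoc mult.commute)
  qed
  also have "\<dots> \<le> M * k powr s * (2 * K * c) * real n powr s"
    using c K k \<open>M > 0\<close> kn s by (intro mult_left_mono powr_mono2) auto
  finally have heavy: "(\<Sum>j\<in>T. d j * x j) \<le> M * k powr s * (2 * K * c) * real n powr s" .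
  \<comment> \<open>For light vertices the threshold supplies \<open>k powr s\<close>, and
    \<open>le_M\<close> on the whole vertex set supplies \<open>n powr s\<close>.\<close>
  have "(\<Sum>j\<in>{..<n} - T. d j * x j) \<le> (\<Sum>j\<in>{..<n} - T. 2 * K * k powr s * x j)"
    using x by (intro sum_mono mult_right_mono) (auto simp: T_def)
  also have "\<dots> = 2 * K * k powr s * sum x ({..<n} - T)" by (simp add: sum_distrib_left)
  also have "\<dots> \<le> 2 * K * k powr s * (M * real n powr s)"
  proof (intro mult_left_mono)
    have "sum x ({..<n} - T) \<le> sum x {..<n}" using x by (intro sum_mono2) auto
    also have "\<dots> \<le> M * real n powr s" using le_M[of "{..<n}"] by simp
    finally show "sum x ({..<n} - T) \<le> M * real n powr s" .
  qed (use K in auto)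
  finally have light: "(\<Sum>j\<in>{..<n} - T. d j * x j) \<le> 2 * K * k powr s * (M * real n powr s)" .
  have "r * sum x A = (\<Sum>i\<in>A. r * x i)" by (simp add: sum_distrib_left)
  also have "\<dots> \<le> (\<Sum>i\<in>A. \<Sum>j<n. a i j * x j)" using AV by (intro sum_mono sub) auto
  also have "\<dots> = (\<Sum>j<n. d j * x j)"
    unfolding d_def sum_distrib_right by (rule sum.swap)
  also have "\<dots> = (\<Sum>j\<in>{..<n} - T. d j * x j) + (\<Sum>j\<in>T. d j * x j)"
    using T by (intro sum.subset_diff) auto
  also have "\<dots> \<le> 2 * K * (1 + c) * real n powr s * (M * k powr s)"
    using heavy light by (simp add: algebra_simps)
  finally have "r * (M * k powr s) \<le> 2 * K * (1 + c) * real n powr s * (M * k powr s)"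
    by (simp add: xA)
  moreover have "M * k powr s > 0" using \<open>M > 0\<close> k by simp
  ultimately have "r \<le> 2 * K * (1 + c) * real n powr s" by (simp only: mult_le_cancel_right_pos)
  thus ?thesis by (simp add: K_def c_def)
qed

section \<open>Growth of spectral Turan numbers\<close>

text \<open>Induced subgraphs inherit \<open>H\<close>-freeness, so the Turan bound makes every
  vertex set sparse. The density constant is \<open>2 * C\<close> because ordered pairs are
  counted.\<close>

lemma spex_num_le_of_ex_num_le:
  assumes H: "simple_graph H" and C: "C \<ge> 0" and s: "s > 1 / 2"
    and ex: "\<And>m. real (ex_num m H) \<le> C * real m powr (1 + s)" and n: "n > 0"
  shows "spex_num n H \<le>
    2 * (2 * C * 2 powr (1 + s)) * (1 + 2 / (1 - 2 powr (1 - 2 * s))) * real n powr s"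
proof (rule spex_num_le)
  fix G assume G: "G \<in> free_graphs n H"
  hence sG: "simple_graph G" by (simp add: free_graphs_def)
  obtain x where x: "\<And>i. x i \<ge> 0" "\<exists>i<n. x i > 0"
    "\<And>i. i < n \<Longrightarrow> graph_spectral_radius n G * x i \<le> (\<Sum>j<n. adj G i j * x j)"
    using graph_spectral_radius_subeigenfunction[OF n] by blast
  have "(\<Sum>i\<in>U. \<Sum>j\<in>U. adj G i j) \<le> 2 * C * real (card U) powr (1 + s)" if U: "U \<subseteq> {..<n}" for U
  proof -
    have "finite U" using U finite_subset by blast
    hence "(\<Sum>i\<in>U. \<Sum>j\<in>U. adj G i j) = 2 * real (card {e \<in> edges G. e \<subseteq> U})"
      by (rule sum_adj_eq_card_edges[OF sG])
    also have "\<dots> \<le> 2 * real (ex_num (card U) H)"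
      using card_induced_edges_le_ex_num[OF H G U] by simp
    also have "\<dots> \<le> 2 * (C * real (card U) powr (1 + s))"
      by (intro mult_left_mono ex) simp
    finally show ?thesis by simp
  qed
  thus "graph_spectral_radius n G \<le>
      2 * (2 * C * 2 powr (1 + s)) * (1 + 2 / (1 - 2 powr (1 - 2 * s))) * real n powr s"
    using subeigenvalue_bound_of_sparse[where a = "adj G" and D = "2 * C" and x = x and n = n,
        OF adj_commute adj_nonneg _ s _ x] C by simp
next
  have "2 powr (1 - 2 * s) < 2 powr 0" using s by (intro powr_less_mono) auto
  thus "0 \<le> 2 * (2 * C * 2 powr (1 + s)) * (1 + 2 / (1 - 2 powr (1 - 2 * s))) * real n powr s"
    using C by simp
qed

text \<open>Sparsity is applied to vertex sets of every size, so small \<open>n\<close> must be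
  covered as well. The finitely many exceptions go into the constant, as
  \<open>real n powr p \<ge> 1\<close> for positive \<open>n\<close>.\<close>

lemma ex_num_le_powr_of_bigo:
  assumes "(\<lambda>n. real (ex_num n H)) \<in> O(\<lambda>n. real n powr p)" "p \<ge> 0"
  obtains C where "C \<ge> 0" "\<And>n. real (ex_num n H) \<le> C * real n powr p"
proof -
  obtain c where c: "c > 0" "eventually (\<lambda>n. norm (real (ex_num n H)) \<le> c * norm (real n powr p)) at_top"
    using assms(1) by (elim landau_o.bigE)
  then obtain N where N: "\<And>n. n \<ge> N \<Longrightarrow> real (ex_num n H) \<le> c * real n powr p"
    by (auto simp: eventually_at_top_linorder)
  define S where "S = (\<Sum>m<N. real (ex_num m H))"
  have S: "S \<ge> 0" by (simp add: S_def sum_nonneg)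
  show thesis
  proof
    show "c + S \<ge> 0" using c(1) S by simp
    show "real (ex_num n H) \<le> (c + S) * real n powr p" for n
    proof (cases "n = 0")
      case False
      hence one: "1 \<le> real n powr p" using assms(2) by (simp add: ge_one_powr_ge_zero)
      show ?thesis
      proof (cases "n < N")
        case True
        have "real (ex_num n H) \<le> S" unfolding S_def using True by (intro member_le_sum) auto
        also have "\<dots> \<le> S * real n powr p" using mult_left_mono[OF one S] by simp
        also have "\<dots> \<le> (c + S) * real n powr p" using c(1) by (intro mult_right_mono) auto
        finally show ?thesis .
      next
        case False
        hence "real (ex_num n H) \<le> c * real n powr p" by (intro N) auto
        also have "\<dots> \<le> (c + S) * real n powr p" using S by (intro mult_right_mono) auto
        finally show ?thesis .
      qed
    qed (simp add: ex_num_0)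
  qed
qed

lemma spex_num_bigtheta_of_ex_num:
  assumes H: "simple_graph H" and s: "s > 1 / 2"
    and ex: "(\<lambda>n. real (ex_num n H)) \<in> \<Theta>(\<lambda>n. real n powr (1 + s))"
  shows "(\<lambda>n. spex_num n H) \<in> \<Theta>(\<lambda>n. real n powr s)"
proof (rule bigthetaI)
  obtain C where C: "C \<ge> 0" "\<And>n. real (ex_num n H) \<le> C * real n powr (1 + s)"
    using ex_num_le_powr_of_bigo[OF bigthetaD1[OF ex]] s by auto
  define c where "c = 2 * (2 * C * 2 powr (1 + s)) * (1 + 2 / (1 - 2 powr (1 - 2 * s)))"
  have "norm (spex_num n H) \<le> c * norm (real n powr s)" if "n > 0" for n
    using spex_num_le_of_ex_num_le[OF H C(1) s C(2) that] spex_num_nonneg[OF that, of H]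
    by (simp add: c_def)
  thus "(\<lambda>n. spex_num n H) \<in> O(\<lambda>n. real n powr s)"
    by (intro bigoI[of _ c]) (auto intro: eventually_mono[OF eventually_gt_at_top[of 0]])
next
  obtain c where c: "c > 0"
    "eventually (\<lambda>n. norm (real (ex_num n H)) \<ge> c * norm (real n powr (1 + s))) at_top"
    using bigthetaD2[OF ex] by (elim landau_omega.bigE)
  have "eventually (\<lambda>n. norm (spex_num n H) \<ge> 2 * c * norm (real n powr s)) at_top"
    using c(2) eventually_gt_at_top[of 0]
  proof eventually_elim
    case (elim n)
    have "real n * (2 * c * real n powr s) = 2 * (c * real n powr (1 + s))"
      using elim(2) by (simp add: powr_add)
    also have "\<dots> \<le> 2 * real (ex_num n H)" using elim(1) by simp
    also have "\<dots> \<le> real n * spex_num n H"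
      using average_degree_le_spex_num[OF elim(2), of H] by (simp add: mult.commute)
    finally show ?case using elim(2) by simp
  qed
  thus "(\<lambda>n. spex_num n H) \<in> \<Omega>(\<lambda>n. real n powr s)"
    using c(1) by (intro landau_omega.bigI[of "2 * c"]) auto
qed

section \<open>The exponent 1/2\<close>

text \<open>Cauchy-Schwarz in each row of the eigenvector equation, i.e. the Frobenius norm bound;
  the entries equal their squares.\<close>

lemma graph_spectral_radius_square_le:
  assumes "n > 0"
  shows "(graph_spectral_radius n G)\<^sup>2 \<le> (\<Sum>i<n. \<Sum>j<n. adj G i j)"
proof -
  define r where "r = graph_spectral_radius n G"
  obtain y where y: "\<exists>i<n. y i \<noteq> 0" "\<And>i. i < n \<Longrightarrow> (\<Sum>j<n. adj G i j * y j) = r * y i"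
    using graph_spectral_radius_eigenfunction[OF assms] unfolding r_def by blast
  define N where "N = (\<Sum>i<n. (y i)\<^sup>2)"
  have N: "N > 0" using y(1) unfolding N_def by (auto intro: sum_pos2)
  have "r\<^sup>2 * N = (\<Sum>i<n. (\<Sum>j<n. adj G i j * y j)\<^sup>2)"
    by (simp add: N_def y(2) power_mult_distrib sum_distrib_left)
  also have "\<dots> \<le> (\<Sum>i<n. (\<Sum>j<n. (adj G i j)\<^sup>2) * N)"
    unfolding N_def by (intro sum_mono Cauchy_Schwarz_ineq_sum)
  also have "\<dots> = (\<Sum>i<n. \<Sum>j<n. adj G i j) * N"
    by (simp add: sum_distrib_right adj_def if_distrib[of "\<lambda>u. u\<^sup>2"] cong: if_cong)
  finally show ?thesis using N by (simp add: r_def)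
qed

text \<open>The matching of size two. It serves the exponent 1/2, which the transfer from
  \<open>ex_num\<close> excludes.\<close>

definition two_edges :: "nat ugraph" where
  "two_edges = ({..<4}, {{0, 1}, {2, 3}})"

lemma simple_two_edges: "simple_graph two_edges"
  by (auto simp: simple_graph_def two_edges_def)

lemma embeds_two_edges:
  assumes G: "simple_graph G" and "e \<in> edges G" "e' \<in> edges G" "e \<inter> e' = {}"
  shows "embeds two_edges G"
proof -
  have "card e = 2" "card e' = 2" "e \<subseteq> vertices G" "e' \<subseteq> vertices G"
    using assms by (auto simp: simple_graph_def)
  then obtain u v p q where uv: "e = {u, v}" "u \<noteq> v" "e' = {p, q}" "p \<noteq> q"
    by (metis card_2_iff)
  define f where "f i = (if i = 0 then u else if i = 1 then v else if i = 2 then p else q)" for i :: nat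
  have 4: "{..<4::nat} = {0, 1, 2, 3}" by auto
  have "inj_on f {..<4}" using uv assms(4) unfolding 4 by (auto simp: f_def)
  moreover have "f ` {..<4} \<subseteq> vertices G"
    using uv \<open>e \<subseteq> _\<close> \<open>e' \<subseteq> _\<close> unfolding 4 by (auto simp: f_def)
  moreover have "f ` {0, 1} = e" "f ` {2, 3} = e'" by (auto simp: f_def uv)
  ultimately show ?thesis using assms(2,3) unfolding embeds_def
    by (intro exI[of _ f]) (auto simp: two_edges_def)
qed

text \<open>All edges of the star share the centre 0, which would need preimages in both disjoint
  edges.\<close>

lemma not_embeds_two_edges_star: "\<not> embeds two_edges (star_graph n)"
proof
  assume "embeds two_edges (star_graph n)"
  then obtain f where f: "inj_on f {..<4::nat}"
    "f ` {0, 1} \<in> edges (star_graph n)" "f ` {2, 3} \<in> edges (star_graph n)"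
    unfolding embeds_def by (auto simp: two_edges_def)
  have 0: "0 \<in> e" if "e \<in> edges (star_graph n)" for e
    using that by (auto simp: star_graph_def)
  obtain i j where ij: "i \<in> {0, 1}" "j \<in> {2, 3}" "f i = 0" "f j = 0"
    using 0[OF f(2)] 0[OF f(3)] by (metis imageE)
  hence "i = j" using inj_onD[OF f(1), of i j] by auto
  thus False using ij by auto
qed

text \<open>Edges intersect pairwise, so the ends \<open>u\<close>, \<open>v\<close> of any one edge
  cover all edges. The adjacency matrix then lives on two rows and two columns and has entry sum at
  most \<open>4 * n\<close>.\<close>

lemma spex_num_two_edges_le:
  assumes n: "n > 0"
  shows "spex_num n two_edges \<le> 2 * sqrt (real n)"
proof (rule spex_num_le)
  fix G assume "G \<in> free_graphs n two_edges"
  hence G: "simple_graph G" "vertices G = {..<n}" "\<not> embeds two_edges G"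
    by (auto simp: free_graphs_def graph_free_iff_not_embeds[OF simple_two_edges])
  have "\<exists>u v. \<forall>e\<in>edges G. u \<in> e \<or> v \<in> e"
  proof (cases "edges G = {}")
    case False
    then obtain e where e: "e \<in> edges G" by blast
    hence "card e = 2" using G(1) by (auto simp: simple_graph_def)
    then obtain u v where "e = {u, v}" by (auto simp: card_2_iff)
    thus ?thesis using embeds_two_edges[OF G(1) e] G(3) by blast
  qed simp
  then obtain u v where uv: "\<And>e. e \<in> edges G \<Longrightarrow> u \<in> e \<or> v \<in> e" by blast
  define \<delta> :: "nat \<Rightarrow> nat \<Rightarrow> real" where "\<delta> i j = of_bool (i = j)" for i j
  have le1: "(\<Sum>i<n. \<delta> i w) \<le> 1" for w
    by (simp add: \<delta>_def of_bool_def sum.delta)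
  have "adj G i j \<le> (\<delta> i u + \<delta> i v) + (\<delta> j u + \<delta> j v)" for i j
    using uv[of "{i, j}"] by (auto simp: adj_def \<delta>_def)
  hence "(\<Sum>i<n. \<Sum>j<n. adj G i j) \<le> (\<Sum>i<n. \<Sum>j<n. (\<delta> i u + \<delta> i v) + (\<delta> j u + \<delta> j v))"
    by (intro sum_mono)
  also have "\<dots> = 2 * real n * ((\<Sum>i<n. \<delta> i u) + (\<Sum>i<n. \<delta> i v))"
    by (simp add: sum.distrib sum_distrib_left[symmetric] algebra_simps)
  also have "\<dots> \<le> 2 * real n * (1 + 1)"
    by (intro mult_left_mono add_mono le1) auto
  finally have "(graph_spectral_radius n G)\<^sup>2 \<le> (2 * sqrt (real n))\<^sup>2"
    using graph_spectral_radius_square_le[OF n, of G] by (simp add: power_mult_distrib)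
  thus "graph_spectral_radius n G \<le> 2 * sqrt (real n)" by (rule power2_le_imp_le) simp
qed simp

lemma sqrt_minus_1_ge:
  assumes "n \<ge> 2"
  shows "1 / 2 * real n powr (1 / 2) \<le> sqrt (real n - 1)"
proof -
  have "1 / 2 * real n powr (1 / 2) = sqrt (real n / 4)"
    by (simp add: powr_half_sqrt real_sqrt_divide)
  also have "\<dots> \<le> sqrt (real n - 1)" using assms by simp
  finally show ?thesis .
qed

lemma spex_num_two_edges_bigtheta: "(\<lambda>n. spex_num n two_edges) \<in> \<Theta>(\<lambda>n. real n powr (1 / 2))"
proof (rule bigthetaI)
  have "norm (spex_num n two_edges) \<le> 2 * norm (real n powr (1 / 2))" if "n > 0" for n
    using spex_num_two_edges_le[OF that] spex_num_nonneg[OF that, of two_edges]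
    by (simp add: powr_half_sqrt)
  thus "(\<lambda>n. spex_num n two_edges) \<in> O(\<lambda>n. real n powr (1 / 2))"
    by (intro bigoI[of _ 2]) (auto intro: eventually_mono[OF eventually_gt_at_top[of 0]])
  have "norm (spex_num n two_edges) \<ge> 1 / 2 * norm (real n powr (1 / 2))" if "n \<ge> 2" for n
    using sqrt_minus_1_ge[OF that]
      sqrt_le_spex_num[of n, OF _ simple_two_edges not_embeds_two_edges_star] that by simp
  thus "(\<lambda>n. spex_num n two_edges) \<in> \<Omega>(\<lambda>n. real n powr (1 / 2))"
    by (intro landau_omega.bigI[of "1 / 2"]) (auto intro: eventually_mono[OF eventually_ge_at_top[of 2]])
qed

section \<open>No exponents strictly between 0 and 1/2\<close>

lemma filterlim_of_nat_powr_at_top: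
  assumes "a > 0"
  shows "filterlim (\<lambda>n. real n powr a) at_top at_top"
  using assms by real_asymp

lemma spex_num_not_bigtheta:
  assumes H: "simple_graph H" and r: "0 < r" "r < 1 / 2"
  shows "(\<lambda>n. spex_num n H) \<notin> \<Theta>(\<lambda>n. real n powr r)"
proof
  assume \<Theta>: "(\<lambda>n. spex_num n H) \<in> \<Theta>(\<lambda>n. real n powr r)"
  show False
  \<comment> \<open>Dichotomy: if \<open>H\<close> lies in a star, \<open>spex_num\<close> is
    bounded, against \<open>r > 0\<close>; otherwise it is at least
    \<open>sqrt (real n - 1)\<close>, against \<open>r < 1 / 2\<close>.\<close>
  proof (cases "\<exists>m>0. embeds H (star_graph m)")
    case True
    then obtain m where m: "m > 0" "embeds H (star_graph m)" by blast
    obtain c where c: "c > 0"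
      "eventually (\<lambda>n. norm (spex_num n H) \<ge> c * norm (real n powr r)) at_top"
      using bigthetaD2[OF \<Theta>] by (elim landau_omega.bigE)
    have "eventually (\<lambda>n. real n powr r > real m / c) at_top"
      using filterlim_of_nat_powr_at_top[OF r(1)] by (simp add: filterlim_at_top_dense)
    with c(2) eventually_gt_at_top[of 0] have "eventually (\<lambda>_. False) (at_top :: nat filter)"
    proof eventually_elim
      case (elim n)
      have "c * real n powr r \<le> real m"
        using elim(1) spex_num_le_of_embeds_star[OF H m elim(2)] spex_num_nonneg[OF elim(2), of H]
        by simp
      thus False using elim(3) c(1) by (simp add: field_simps)
    qed
    thus False by simp
  next
    case False
    obtain c where c: "c > 0"
      "eventually (\<lambda>n. norm (spex_num n H) \<le> c * norm (real n powr r)) at_top"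
      using bigthetaD1[OF \<Theta>] by (elim landau_o.bigE)
    have "eventually (\<lambda>n. real n powr (1 / 2 - r) > 2 * c) at_top"
      using filterlim_of_nat_powr_at_top[of "1 / 2 - r"] r(2) by (simp add: filterlim_at_top_dense)
    with c(2) eventually_ge_at_top[of 2] have "eventually (\<lambda>_. False) (at_top :: nat filter)"
    proof eventually_elim
      case (elim n)
      have n: "n > 0" using elim(2) by simp
      have "1 / 2 * real n powr (1 / 2) \<le> spex_num n H"
        using sqrt_minus_1_ge[OF elim(2)] sqrt_le_spex_num[OF n H] False n
        by (meson order_trans)
      also have "\<dots> \<le> c * real n powr r" using elim(1) by simp
      finally have "real n powr (1 / 2) \<le> 2 * c * real n powr r" by simp
      also have "real n powr (1 / 2) = real n powr (1 / 2 - r) * real n powr r"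
        by (simp add: powr_add[symmetric])
      finally show False using elim(3) n by simp
    qed
    thus False by simp
  qed
qed

theorem theorem1p9:
  shows "((\<forall>r::real. r \<in> \<rat> \<and> 1 \<le> r \<and> r \<le> 2 \<longrightarrow>
             (\<exists>H :: nat ugraph. simple_graph H \<and>
                (\<lambda>n. real (ex_num n H)) \<in> \<Theta>(\<lambda>n. real n powr r))) \<longrightarrow>
          (\<forall>r::real. r \<in> \<rat> \<and> 1 / 2 \<le> r \<and> r \<le> 1 \<longrightarrow>
             (\<exists>H :: nat ugraph. simple_graph H \<and>
                (\<lambda>n. spex_num n H) \<in> \<Theta>(\<lambda>n. real n powr r)))) \<and>
         (\<forall>r::real. r \<in> \<rat> \<and> 0 < r \<and> r < 1 / 2 \<longrightarrow>
             \<not> (\<exists>H :: nat ugraph. simple_graph H \<and>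
                (\<lambda>n. spex_num n H) \<in> \<Theta>(\<lambda>n. real n powr r)))"
proof (intro conjI impI allI)
  fix r :: real
  assume ex: "\<forall>r::real. r \<in> \<rat> \<and> 1 \<le> r \<and> r \<le> 2 \<longrightarrow>
             (\<exists>H :: nat ugraph. simple_graph H \<and>
                (\<lambda>n. real (ex_num n H)) \<in> \<Theta>(\<lambda>n. real n powr r))"
    and r: "r \<in> \<rat> \<and> 1 / 2 \<le> r \<and> r \<le> 1"
  show "\<exists>H :: nat ugraph. simple_graph H \<and> (\<lambda>n. spex_num n H) \<in> \<Theta>(\<lambda>n. real n powr r)"
  proof (cases "r = 1 / 2")
    case True
    thus ?thesis using simple_two_edges spex_num_two_edges_bigtheta by blast
  next
    case False
    \<comment> \<open>Here \<open>r > 1 / 2\<close>, so the Turan exponent \<open>1 + r\<close> lies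
      above 3/2 and at most at 2, within reach of the transfer.\<close>
    have "1 + r \<in> \<rat>" using r by simp
    then obtain H :: "nat ugraph" where H: "simple_graph H"
      "(\<lambda>n. real (ex_num n H)) \<in> \<Theta>(\<lambda>n. real n powr (1 + r))"
      using ex[rule_format, of "1 + r"] r by auto
    hence "(\<lambda>n. spex_num n H) \<in> \<Theta>(\<lambda>n. real n powr r)"
      using False r by (intro spex_num_bigtheta_of_ex_num) auto
    thus ?thesis using H by blast
  qed
next
  fix r :: real
  assume "r \<in> \<rat> \<and> 0 < r \<and> r < 1 / 2"
  thus "\<not> (\<exists>H :: nat ugraph. simple_graph H \<and> (\<lambda>n. spex_num n H) \<in> \<Theta>(\<lambda>n. real n powr r))"
    using spex_num_not_bigtheta by blast
qed

end
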